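(* Let $(A,\varrho_A,[\cdot,\cdot])$ be a skew-symmetric algebroid over a manifold $M$ equipped with a pseudo-Riemannian metric $g\in\Gamma(\mathsf{S}^2A^* )$ in $A$ and a symmetric bracket $\langle\cdot:\cdot\rangle:\Gamma(A)\times\Gamma(A)\to\Gamma(A)$. Let $T\in\Gamma(\bigwedge^2A^*\otimes A)$ and let $\nabla$ be the $A$-connection in $A$ given by $$\nabla_XY=\tfrac12\big([X,Y]+\langle X:Y\rangle\big)+\tfrac12T(X,Y)$$ for $X,Y\in\Gamma(A)$ (so that $T$ is the torsion of $\nabla$), and suppose that $\nabla$ has totally skew-symmetric torsion with respect to $g$. Then for every $X\in\Gamma(A)$, $$(i_X\circ\nabla)g=\tfrac12\big(\mathcal{L}^a_X+\mathcal{L}^s_X\big)g.$$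
   Context: A skew-symmetric algebroid $(A,\varrho_A,[\cdot,\cdot])$ over $M$ is a vector bundle $A\to M$ with a vector bundle homomorphism $\varrho_A:A\to TM$ over the identity (anchor) and an $\mathbb{R}$-bilinear skew-symmetric map $[\cdot,\cdot]:\Gamma(A)\times\Gamma(A)\to\Gamma(A)$ with $[X,fY]=f[X,Y]+(\varrho_A\circ X)(f)\,Y$ for $X,Y\in\Gamma(A)$, $f\in C^\infty(M)$ (no Jacobi identity is assumed, and the anchor need not preserve brackets). A symmetric bracket is an $\mathbb{R}$-bilinear symmetric map $\langle\cdot:\cdot\rangle:\Gamma(A)\times\Gamma(A)\to\Gamma(A)$ with $\langle X:fY\rangle=f\langle X:Y\rangle+(\varrho_A\circ X)(f)Y$. An $A$-connection in $A$ is an $\mathbb{R}$-bilinear map $\nabla:\Gamma(A)\times\Gamma(A)\to\Gamma(A)$ with $\nabla_{fX}Y=f\nabla_XY$ and $\nabla_X(fY)=f\nabla_XY+(\varrho_A\circ X)(f)Y$. Its torsion is $T^\nabla(X,Y)=\nabla_XY-\nabla_YX-[X,Y]$; it is totally skew-symmetric with respect to $g$ if $(X,Y,Z)\mapsto g(T^\nabla(X,Y),Z)$ is a $3$-form, i.e. in $\Gamma(\bigwedge^3A^* )$. A pseudo-Riemannian metric $g$ in $A$ is a nondegenerate section of $\mathsf{S}^2A^*$. One has $((i_X\circ\nabla)g)(Y,Z)=(\nabla_Xg)(Y,Z)=(\varrho_A\circ X)(g(Y,Z))-g(\nabla_XY,Z)-g(Y,\nabla_XZ)$. The alternating and the symmetric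 Lie derivatives of $g$ are $(\mathcal{L}^a_Xg)(Y,Z)=(\varrho_A\circ X)(g(Y,Z))-g([X,Y],Z)-g(Y,[X,Z])$ and $(\mathcal{L}^s_Xg)(Y,Z)=(\varrho_A\circ X)(g(Y,Z))-g(\langle X:Y\rangle,Z)-g(Y,\langle X:Z\rangle)$. *)

theory Defs
  imports "HOL-Analysis.Analysis"
begin

section \<open>Smooth manifolds\<close>

text \<open>
  \<open>Euclidean_space n\<close> models \<open>\<real>\<^sup>n\<close>, including \<open>n = 0\<close>, by the functions \<open>x :: nat \<Rightarrow> real\<close> with
  \<open>x i = 0\<close> for \<open>i \<ge> n\<close>. \<open>C_k n k U f\<close>: all iterated partial derivatives of \<open>f\<close> of order at most
  \<open>k\<close> exist and are continuous on the open set \<open>U \<subseteq> \<real>\<^sup>n\<close>.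
\<close>

primrec C_k :: "nat \<Rightarrow> nat \<Rightarrow> (nat \<Rightarrow> real) set \<Rightarrow> ((nat \<Rightarrow> real) \<Rightarrow> real) \<Rightarrow> bool" where
  "C_k n 0 U f \<longleftrightarrow> continuous_map (subtopology (Euclidean_space n) U) euclideanreal f"
| "C_k n (Suc k) U f \<longleftrightarrow>
     continuous_map (subtopology (Euclidean_space n) U) euclideanreal f \<and>
     (\<forall>i<n. \<exists>f'. C_k n k U f' \<and>
        (\<forall>x\<in>U. ((\<lambda>t. f (x(i := t))) has_real_derivative f' x) (at (x i))))"

definition C_infinity :: "nat \<Rightarrow> (nat \<Rightarrow> real) set \<Rightarrow> ((nat \<Rightarrow> real) \<Rightarrow> real) \<Rightarrow> bool" where
  "C_infinity n U f \<longleftrightarrow> (\<forall>k. C_k n k U f)"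

type_synonym 'm chart = "'m set \<times> ('m \<Rightarrow> nat \<Rightarrow> real)"

record 'm manifold =
  mdim :: nat
  mtop :: "'m topology"
  atlas :: "'m chart set"

abbreviation points :: "'m manifold \<Rightarrow> 'm set" where
  "points M \<equiv> topspace (mtop M)"

text \<open>The atlas need not be maximal; it determines the smooth structure.\<close>

definition smooth_manifold :: "'m manifold \<Rightarrow> bool" where
  "smooth_manifold M \<longleftrightarrow>
     Hausdorff_space (mtop M) \<and> second_countable (mtop M) \<and>
     (\<Union>(V, \<phi>)\<in>atlas M. V) = points M \<and>
     (\<forall>(V, \<phi>)\<in>atlas M.
        openin (mtop M) V \<and> openin (Euclidean_space (mdim M)) (\<phi> ` V) \<and>
        homeomorphic_map (subtopology (mtop M) V)
          (subtopology (Euclidean_space (mdim M)) (\<phi> ` V)) \<phi>) \<and>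
     (\<forall>(V, \<phi>)\<in>atlas M. \<forall>(W, \<psi>)\<in>atlas M. \<forall>i<mdim M.
        C_infinity (mdim M) (\<phi> ` (V \<inter> W)) (\<lambda>x. \<psi> (inv_into V \<phi> x) i))"

definition smooth_on :: "'m manifold \<Rightarrow> 'm set \<Rightarrow> ('m \<Rightarrow> real) \<Rightarrow> bool" where
  "smooth_on M W f \<longleftrightarrow> openin (mtop M) W \<and>
     (\<forall>(V, \<phi>)\<in>atlas M. C_infinity (mdim M) (\<phi> ` (V \<inter> W)) (\<lambda>x. f (inv_into V \<phi> x)))"

definition smooth_functions :: "'m manifold \<Rightarrow> ('m \<Rightarrow> real) set" where
  "smooth_functions M = {f. smooth_on M (points M) f}"

section \<open>Tangent vectors\<close>

text \<open>
  Tangent vectors at \<open>p\<close> are the derivations of \<open>C\<^sup>\<infinity>(M)\<close> at \<open>p\<close>, extended by \<open>0\<close> to functions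
  that are not smooth. (The values of a smooth function outside \<open>M\<close> are arbitrary, but the Leibniz
  rule makes a derivation at \<open>p \<in> M\<close> insensitive to them.)
\<close>

definition tangent_space :: "'m manifold \<Rightarrow> 'm \<Rightarrow> (('m \<Rightarrow> real) \<Rightarrow> real) set" where
  "tangent_space M p = {v.
     (\<forall>f\<in>smooth_functions M. \<forall>h\<in>smooth_functions M.
        v (\<lambda>q. f q + h q) = v f + v h \<and>
        v (\<lambda>q. f q * h q) = f p * v h + h p * v f) \<and>
     (\<forall>f\<in>smooth_functions M. \<forall>c. v (\<lambda>q. c * f q) = c * v f) \<and>
     (\<forall>f. f \<notin> smooth_functions M \<longrightarrow> v f = 0)}"

text \<open>The vector \<open>\<partial>/\<partial>x\<^sup>i\<close> at \<open>p\<close> of a chart.\<close>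

definition coordinate_vector :: "'m manifold \<Rightarrow> 'm chart \<Rightarrow> nat \<Rightarrow> 'm \<Rightarrow> ('m \<Rightarrow> real) \<Rightarrow> real" where
  "coordinate_vector M = (\<lambda>(V, \<phi>) i p f.
     if f \<in> smooth_functions M
     then deriv (\<lambda>t. f (inv_into V \<phi> ((\<phi> p)(i := t)))) (\<phi> p i) else 0)"

section \<open>Vector bundles and their sections\<close>

text \<open>
  The total space is the disjoint union of the fibres \<open>fibre A p\<close>, \<open>p \<in> M\<close>. The fibres are linear
  subspaces of one real vector space \<open>'v\<close>, which only supplies the operations: it need not have a
  topology, and different fibres are unrelated. The smooth structure is given by a bundle atlas,
  each local trivialization \<open>(p, c) \<mapsto> \<Sum>i<r. c i *\<^sub>R e i p\<close> over \<open>U\<close> being recorded as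
  the local frame \<open>(U, e)\<close>.
\<close>

record ('m, 'v) vbundle =
  fibre_dim :: nat
  fibre :: "'m \<Rightarrow> 'v set"
  frames :: "('m set \<times> (nat \<Rightarrow> 'm \<Rightarrow> 'v)) set"

definition vector_bundle :: "'m manifold \<Rightarrow> ('m, 'v::real_vector) vbundle \<Rightarrow> bool" where
  "vector_bundle M A \<longleftrightarrow>
     smooth_manifold M \<and>
     (\<Union>(U, e)\<in>frames A. U) = points M \<and>
     (\<forall>(U, e)\<in>frames A. openin (mtop M) U \<and>
        (\<forall>p\<in>U. inj_on (\<lambda>i. e i p) {..<fibre_dim A} \<and>
               independent ((\<lambda>i. e i p) ` {..<fibre_dim A}) \<and>
               span ((\<lambda>i. e i p) ` {..<fibre_dim A}) = fibre A p)) \<and>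
     (\<forall>(U, e)\<in>frames A. \<forall>(U', e')\<in>frames A. \<forall>j<fibre_dim A.
        \<exists>c. (\<forall>i<fibre_dim A. smooth_on M (U \<inter> U') (c i)) \<and>
            (\<forall>p\<in>U \<inter> U'. e' j p = (\<Sum>i<fibre_dim A. c i p *\<^sub>R e i p)))"

text \<open>
  \<open>\<Gamma>(A)\<close>. Sections are \<open>0\<close> outside \<open>M\<close>, so that equality of sections is equality of functions.
\<close>

definition sections :: "'m manifold \<Rightarrow> ('m, 'v::real_vector) vbundle \<Rightarrow> ('m \<Rightarrow> 'v) set" where
  "sections M A = {X.
     (\<forall>p\<in>points M. X p \<in> fibre A p) \<and> (\<forall>p. p \<notin> points M \<longrightarrow> X p = 0) \<and>
     (\<forall>(U, e)\<in>frames A. \<exists>c. (\<forall>i<fibre_dim A. smooth_on M U (c i)) \<and>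
        (\<forall>p\<in>U. X p = (\<Sum>i<fibre_dim A. c i p *\<^sub>R e i p)))}"

text \<open>
  Vector bundle homomorphisms \<open>A \<rightarrow> TM\<close> over the identity; smoothness is expressed by the matrix
  coefficients with respect to local frames of \<open>A\<close> and coordinate frames of \<open>TM\<close>. The derivative
  \<open>(\<rho> \<circ> X)(f)\<close> of a function along a section is \<open>\<lambda>p. \<rho> p (X p) f\<close>.
\<close>

definition bundle_hom_to_tangent ::
  "'m manifold \<Rightarrow> ('m, 'v::real_vector) vbundle \<Rightarrow> ('m \<Rightarrow> 'v \<Rightarrow> ('m \<Rightarrow> real) \<Rightarrow> real) \<Rightarrow> bool" where
  "bundle_hom_to_tangent M A \<rho> \<longleftrightarrow>
     (\<forall>p\<in>points M. \<forall>a\<in>fibre A p. \<rho> p a \<in> tangent_space M p) \<and>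
     (\<forall>p\<in>points M. \<forall>a\<in>fibre A p. \<forall>b\<in>fibre A p. \<forall>f. \<rho> p (a + b) f = \<rho> p a f + \<rho> p b f) \<and>
     (\<forall>p\<in>points M. \<forall>a\<in>fibre A p. \<forall>c f. \<rho> p (c *\<^sub>R a) f = c * \<rho> p a f) \<and>
     (\<forall>(U, e)\<in>frames A. \<forall>(V, \<phi>)\<in>atlas M. \<forall>j<fibre_dim A.
        \<exists>c. (\<forall>i<mdim M. smooth_on M (U \<inter> V) (c i)) \<and>
            (\<forall>p\<in>U \<inter> V. \<forall>f. \<rho> p (e j p) f =
               (\<Sum>i<mdim M. c i p * coordinate_vector M (V, \<phi>) i p f)))"

section \<open>Tensors\<close>

definition bilinear_between ::
  "'v::real_vector set \<Rightarrow> 'w::real_vector set \<Rightarrow> ('v \<Rightarrow> 'v \<Rightarrow> 'w) \<Rightarrow> bool" where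
  "bilinear_between E F b \<longleftrightarrow>
     (\<forall>x\<in>E. \<forall>y\<in>E. b x y \<in> F) \<and>
     (\<forall>x\<in>E. \<forall>y\<in>E. \<forall>z\<in>E. b (x + y) z = b x z + b y z \<and> b x (y + z) = b x y + b x z) \<and>
     (\<forall>x\<in>E. \<forall>y\<in>E. \<forall>c. b (c *\<^sub>R x) y = c *\<^sub>R b x y \<and> b x (c *\<^sub>R y) = c *\<^sub>R b x y)"

text \<open>\<open>\<Gamma>(S\<^sup>2A\<^sup>*)\<close>\<close>

definition symmetric_two_tensor ::
  "'m manifold \<Rightarrow> ('m, 'v::real_vector) vbundle \<Rightarrow> ('m \<Rightarrow> 'v \<Rightarrow> 'v \<Rightarrow> real) \<Rightarrow> bool" where
  "symmetric_two_tensor M A g \<longleftrightarrow>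
     (\<forall>p\<in>points M. bilinear_between (fibre A p) UNIV (g p) \<and>
        (\<forall>a\<in>fibre A p. \<forall>b\<in>fibre A p. g p a b = g p b a)) \<and>
     (\<forall>(U, e)\<in>frames A. \<forall>i<fibre_dim A. \<forall>j<fibre_dim A. smooth_on M U (\<lambda>p. g p (e i p) (e j p)))"

definition pseudo_riemannian_metric ::
  "'m manifold \<Rightarrow> ('m, 'v::real_vector) vbundle \<Rightarrow> ('m \<Rightarrow> 'v \<Rightarrow> 'v \<Rightarrow> real) \<Rightarrow> bool" where
  "pseudo_riemannian_metric M A g \<longleftrightarrow> symmetric_two_tensor M A g \<and>
     (\<forall>p\<in>points M. \<forall>a\<in>fibre A p. (\<forall>b\<in>fibre A p. g p a b = 0) \<longrightarrow> a = 0)"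

text \<open>\<open>\<Gamma>(\<Lambda>\<^sup>2A\<^sup>* \<otimes> A)\<close>\<close>

definition vector_valued_two_form ::
  "'m manifold \<Rightarrow> ('m, 'v::real_vector) vbundle \<Rightarrow> ('m \<Rightarrow> 'v \<Rightarrow> 'v \<Rightarrow> 'v) \<Rightarrow> bool" where
  "vector_valued_two_form M A T \<longleftrightarrow>
     (\<forall>p\<in>points M. bilinear_between (fibre A p) (fibre A p) (T p) \<and>
        (\<forall>a\<in>fibre A p. T p a a = 0)) \<and>
     (\<forall>(U, e)\<in>frames A. \<forall>i<fibre_dim A. \<forall>j<fibre_dim A.
        \<exists>c. (\<forall>k<fibre_dim A. smooth_on M U (c k)) \<and>
            (\<forall>p\<in>U. T p (e i p) (e j p) = (\<Sum>k<fibre_dim A. c k p *\<^sub>R e k p)))"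

text \<open>\<open>\<Gamma>(\<Lambda>\<^sup>3A\<^sup>*)\<close>\<close>

definition three_form ::
  "'m manifold \<Rightarrow> ('m, 'v::real_vector) vbundle \<Rightarrow> ('m \<Rightarrow> 'v \<Rightarrow> 'v \<Rightarrow> 'v \<Rightarrow> real) \<Rightarrow> bool" where
  "three_form M A \<omega> \<longleftrightarrow>
     (\<forall>p\<in>points M. \<forall>a\<in>fibre A p.
        bilinear_between (fibre A p) UNIV (\<lambda>b c. \<omega> p a b c) \<and>
        bilinear_between (fibre A p) UNIV (\<lambda>b c. \<omega> p b a c) \<and>
        (\<forall>b\<in>fibre A p. \<omega> p a a b = 0 \<and> \<omega> p a b a = 0 \<and> \<omega> p b a a = 0)) \<and>
     (\<forall>(U, e)\<in>frames A. \<forall>i<fibre_dim A. \<forall>j<fibre_dim A. \<forall>k<fibre_dim A.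
        smooth_on M U (\<lambda>p. \<omega> p (e i p) (e j p) (e k p)))"

section \<open>Skew-symmetric algebroids, symmetric brackets and connections\<close>

definition section_bilinear ::
  "'m manifold \<Rightarrow> ('m, 'v::real_vector) vbundle \<Rightarrow>
   (('m \<Rightarrow> 'v) \<Rightarrow> ('m \<Rightarrow> 'v) \<Rightarrow> 'm \<Rightarrow> 'v) \<Rightarrow> bool" where
  "section_bilinear M A B \<longleftrightarrow>
     (\<forall>X\<in>sections M A. \<forall>Y\<in>sections M A. B X Y \<in> sections M A) \<and>
     (\<forall>X\<in>sections M A. \<forall>Y\<in>sections M A. \<forall>Z\<in>sections M A.
        B (\<lambda>p. X p + Y p) Z = (\<lambda>p. B X Z p + B Y Z p) \<and>
        B X (\<lambda>p. Y p + Z p) = (\<lambda>p. B X Y p + B X Z p)) \<and>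
     (\<forall>X\<in>sections M A. \<forall>Y\<in>sections M A. \<forall>c.
        B (\<lambda>p. c *\<^sub>R X p) Y = (\<lambda>p. c *\<^sub>R B X Y p) \<and>
        B X (\<lambda>p. c *\<^sub>R Y p) = (\<lambda>p. c *\<^sub>R B X Y p))"

definition leibniz_rule ::
  "'m manifold \<Rightarrow> ('m, 'v::real_vector) vbundle \<Rightarrow> ('m \<Rightarrow> 'v \<Rightarrow> ('m \<Rightarrow> real) \<Rightarrow> real) \<Rightarrow>
   (('m \<Rightarrow> 'v) \<Rightarrow> ('m \<Rightarrow> 'v) \<Rightarrow> 'm \<Rightarrow> 'v) \<Rightarrow> bool" where
  "leibniz_rule M A \<rho> B \<longleftrightarrow>
     (\<forall>X\<in>sections M A. \<forall>Y\<in>sections M A. \<forall>f\<in>smooth_functions M.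
        B X (\<lambda>p. f p *\<^sub>R Y p) = (\<lambda>p. f p *\<^sub>R B X Y p + \<rho> p (X p) f *\<^sub>R Y p))"

definition skew_symmetric_algebroid ::
  "'m manifold \<Rightarrow> ('m, 'v::real_vector) vbundle \<Rightarrow> ('m \<Rightarrow> 'v \<Rightarrow> ('m \<Rightarrow> real) \<Rightarrow> real) \<Rightarrow>
   (('m \<Rightarrow> 'v) \<Rightarrow> ('m \<Rightarrow> 'v) \<Rightarrow> 'm \<Rightarrow> 'v) \<Rightarrow> bool" where
  "skew_symmetric_algebroid M A \<rho> br \<longleftrightarrow>
     vector_bundle M A \<and> bundle_hom_to_tangent M A \<rho> \<and>
     section_bilinear M A br \<and>
     (\<forall>X\<in>sections M A. \<forall>Y\<in>sections M A. br X Y = (\<lambda>p. - br Y X p)) \<and>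
     leibniz_rule M A \<rho> br"

definition symmetric_bracket ::
  "'m manifold \<Rightarrow> ('m, 'v::real_vector) vbundle \<Rightarrow> ('m \<Rightarrow> 'v \<Rightarrow> ('m \<Rightarrow> real) \<Rightarrow> real) \<Rightarrow>
   (('m \<Rightarrow> 'v) \<Rightarrow> ('m \<Rightarrow> 'v) \<Rightarrow> 'm \<Rightarrow> 'v) \<Rightarrow> bool" where
  "symmetric_bracket M A \<rho> sb \<longleftrightarrow>
     section_bilinear M A sb \<and>
     (\<forall>X\<in>sections M A. \<forall>Y\<in>sections M A. sb X Y = sb Y X) \<and>
     leibniz_rule M A \<rho> sb"

definition A_connection ::
  "'m manifold \<Rightarrow> ('m, 'v::real_vector) vbundle \<Rightarrow> ('m \<Rightarrow> 'v \<Rightarrow> ('m \<Rightarrow> real) \<Rightarrow> real) \<Rightarrow>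
   (('m \<Rightarrow> 'v) \<Rightarrow> ('m \<Rightarrow> 'v) \<Rightarrow> 'm \<Rightarrow> 'v) \<Rightarrow> bool" where
  "A_connection M A \<rho> nabla \<longleftrightarrow>
     section_bilinear M A nabla \<and>
     (\<forall>X\<in>sections M A. \<forall>Y\<in>sections M A. \<forall>f\<in>smooth_functions M.
        nabla (\<lambda>p. f p *\<^sub>R X p) Y = (\<lambda>p. f p *\<^sub>R nabla X Y p)) \<and>
     leibniz_rule M A \<rho> nabla"

definition torsion ::
  "(('m \<Rightarrow> 'v) \<Rightarrow> ('m \<Rightarrow> 'v) \<Rightarrow> 'm \<Rightarrow> 'v::real_vector) \<Rightarrow>
   (('m \<Rightarrow> 'v) \<Rightarrow> ('m \<Rightarrow> 'v) \<Rightarrow> 'm \<Rightarrow> 'v) \<Rightarrow> ('m \<Rightarrow> 'v) \<Rightarrow> ('m \<Rightarrow> 'v) \<Rightarrow> 'm \<Rightarrow> 'v" where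
  "torsion br nabla X Y = (\<lambda>p. nabla X Y p - nabla Y X p - br X Y p)"

definition totally_skew_symmetric_torsion ::
  "'m manifold \<Rightarrow> ('m, 'v::real_vector) vbundle \<Rightarrow>
   (('m \<Rightarrow> 'v) \<Rightarrow> ('m \<Rightarrow> 'v) \<Rightarrow> 'm \<Rightarrow> 'v) \<Rightarrow> ('m \<Rightarrow> 'v \<Rightarrow> 'v \<Rightarrow> real) \<Rightarrow>
   (('m \<Rightarrow> 'v) \<Rightarrow> ('m \<Rightarrow> 'v) \<Rightarrow> 'm \<Rightarrow> 'v) \<Rightarrow> bool" where
  "totally_skew_symmetric_torsion M A br g nabla \<longleftrightarrow>
     (\<exists>\<omega>. three_form M A \<omega> \<and>
        (\<forall>X\<in>sections M A. \<forall>Y\<in>sections M A. \<forall>Z\<in>sections M A. \<forall>p\<in>points M.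
           g p (torsion br nabla X Y p) (Z p) = \<omega> p (X p) (Y p) (Z p)))"

section \<open>Derivatives of the metric\<close>

text \<open>\<open>((i\<^sub>X \<circ> \<nabla>)g)(Y, Z) = (\<nabla>\<^sub>X g)(Y, Z)\<close>\<close>

definition covariant_derivative_metric ::
  "('m \<Rightarrow> 'v \<Rightarrow> ('m \<Rightarrow> real) \<Rightarrow> real) \<Rightarrow> (('m \<Rightarrow> 'v) \<Rightarrow> ('m \<Rightarrow> 'v) \<Rightarrow> 'm \<Rightarrow> 'v) \<Rightarrow>
   ('m \<Rightarrow> 'v \<Rightarrow> 'v \<Rightarrow> real) \<Rightarrow> ('m \<Rightarrow> 'v) \<Rightarrow> ('m \<Rightarrow> 'v) \<Rightarrow> ('m \<Rightarrow> 'v) \<Rightarrow> 'm \<Rightarrow> real" where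
  "covariant_derivative_metric \<rho> nabla g X Y Z =
     (\<lambda>p. \<rho> p (X p) (\<lambda>q. g q (Y q) (Z q)) - g p (nabla X Y p) (Z p) - g p (Y p) (nabla X Z p))"

definition alternating_lie_derivative_metric ::
  "('m \<Rightarrow> 'v \<Rightarrow> ('m \<Rightarrow> real) \<Rightarrow> real) \<Rightarrow> (('m \<Rightarrow> 'v) \<Rightarrow> ('m \<Rightarrow> 'v) \<Rightarrow> 'm \<Rightarrow> 'v) \<Rightarrow>
   ('m \<Rightarrow> 'v \<Rightarrow> 'v \<Rightarrow> real) \<Rightarrow> ('m \<Rightarrow> 'v) \<Rightarrow> ('m \<Rightarrow> 'v) \<Rightarrow> ('m \<Rightarrow> 'v) \<Rightarrow> 'm \<Rightarrow> real" where
  "alternating_lie_derivative_metric \<rho> br g X Y Z =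
     (\<lambda>p. \<rho> p (X p) (\<lambda>q. g q (Y q) (Z q)) - g p (br X Y p) (Z p) - g p (Y p) (br X Z p))"

definition symmetric_lie_derivative_metric ::
  "('m \<Rightarrow> 'v \<Rightarrow> ('m \<Rightarrow> real) \<Rightarrow> real) \<Rightarrow> (('m \<Rightarrow> 'v) \<Rightarrow> ('m \<Rightarrow> 'v) \<Rightarrow> 'm \<Rightarrow> 'v) \<Rightarrow>
   ('m \<Rightarrow> 'v \<Rightarrow> 'v \<Rightarrow> real) \<Rightarrow> ('m \<Rightarrow> 'v) \<Rightarrow> ('m \<Rightarrow> 'v) \<Rightarrow> ('m \<Rightarrow> 'v) \<Rightarrow> 'm \<Rightarrow> real" where
  "symmetric_lie_derivative_metric \<rho> sb g X Y Z =
     (\<lambda>p. \<rho> p (X p) (\<lambda>q. g q (Y q) (Z q)) - g p (sb X Y p) (Z p) - g p (Y p) (sb X Z p))"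

end

theory Submission
  imports Defs
begin

text \<open>
  The covariant derivative \<open>(\<nabla>\<^sub>X g)(Y, Z)\<close> depends affinely on the bracket-like operation that is
  put in place of \<open>\<nabla>\<close>, and both Lie derivatives are the same expression with \<open>[\<cdot>,\<cdot>]\<close> and
  \<open>\<langle>\<cdot>:\<cdot>\<rangle>\<close> in that place. Since \<open>\<nabla>\<close> is the mean of the two brackets plus \<open>T/2\<close>, the difference of
  the two sides is \<open>- (g(T(X,Y),Z) + g(Y,T(X,Z)))/2\<close>. Skew-symmetry of \<open>[\<cdot>,\<cdot>]\<close> and \<open>T\<close> and symmetry
  of \<open>\<langle>\<cdot>:\<cdot>\<rangle>\<close> make \<open>T\<close> the torsion of \<open>\<nabla>\<close> (\<open>torsion_eq_two_form\<close>), so that \<open>g(T(X,Y),Z)\<close> is a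
  \<open>3\<close>-form. It therefore changes sign when \<open>Y\<close> and \<open>Z\<close> are exchanged, and the difference vanishes
  (\<open>metric_torsion_swap\<close>).
\<close>

lemma alternating_bilinear_skew:
  assumes b: "bilinear_between E F b" and E: "subspace E"
    and alt: "\<And>a. a \<in> E \<Longrightarrow> b a a = 0" and x: "x \<in> E" and y: "y \<in> E"
  shows "b x y = - b y x"
proof -
  have xy: "x + y \<in> E"
    using E x y by (rule subspace_add)
  have "b (x + y) (x + y) = b x (x + y) + b y (x + y)"
    using b x y xy unfolding bilinear_between_def by blast
  also have "\<dots> = (b x x + b x y) + (b y x + b y y)"
    using b x y unfolding bilinear_between_def by metis
  finally have "b x y + b y x = 0"
    using alt x y xy by simp
  then show ?thesis
    by (rule eq_neg_iff_add_eq_0[THEN iffD2])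
qed

lemma subspace_fibre:
  assumes "vector_bundle M A" and "p \<in> points M"
  shows "subspace (fibre A p)"
proof -
  have "p \<in> (\<Union>(U, e)\<in>frames A. U)"
    using assms by (simp only: vector_bundle_def)
  then obtain U e where "(U, e) \<in> frames A" "p \<in> U"
    by auto
  moreover have "\<forall>(U, e)\<in>frames A. openin (mtop M) U \<and>
        (\<forall>p\<in>U. inj_on (\<lambda>i. e i p) {..<fibre_dim A} \<and>
               independent ((\<lambda>i. e i p) ` {..<fibre_dim A}) \<and>
               span ((\<lambda>i. e i p) ` {..<fibre_dim A}) = fibre A p)"
    using assms(1) unfolding vector_bundle_def by (elim conjE)
  ultimately have "span ((\<lambda>i. e i p) ` {..<fibre_dim A}) = fibre A p"
    by fastforce
  then show ?thesis
    by (metis subspace_span)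
qed

lemma section_in_fibre: "X \<in> sections M A \<Longrightarrow> p \<in> points M \<Longrightarrow> X p \<in> fibre A p"
  unfolding sections_def by blast

lemma section_bilinear_closed:
  "section_bilinear M A B \<Longrightarrow> X \<in> sections M A \<Longrightarrow> Y \<in> sections M A \<Longrightarrow> B X Y \<in> sections M A"
  unfolding section_bilinear_def by blast

text \<open>
  Antisymmetrizing the formula for \<open>\<nabla>\<close> cancels the symmetric bracket and doubles both the
  alternating bracket and \<open>T\<close>; the torsion removes the former.
\<close>

lemma torsion_eq_two_form:
  assumes alg: "skew_symmetric_algebroid M A \<rho> br"
    and sb: "symmetric_bracket M A \<rho> sb"
    and T: "vector_valued_two_form M A T"
    and nabla: "\<forall>X\<in>sections M A. \<forall>Y\<in>sections M A. \<forall>p\<in>points M.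
           nabla X Y p = (1 / 2) *\<^sub>R (br X Y p + sb X Y p) + (1 / 2) *\<^sub>R T p (X p) (Y p)"
    and X: "X \<in> sections M A" and Y: "Y \<in> sections M A" and p: "p \<in> points M"
  shows "torsion br nabla X Y p = T p (X p) (Y p)"
proof -
  have "vector_bundle M A"
    using alg unfolding skew_symmetric_algebroid_def by blast
  then have E: "subspace (fibre A p)"
    using p by (rule subspace_fibre)
  have T_skew: "T p (Y p) (X p) = - T p (X p) (Y p)"
    using T p X Y
    by (intro alternating_bilinear_skew[OF _ E])
      (auto simp: vector_valued_two_form_def section_in_fibre)
  have "br Y X = (\<lambda>q. - br X Y q)"
    using alg X Y unfolding skew_symmetric_algebroid_def by blast
  then have br_skew: "br Y X p = - br X Y p"
    by (rule fun_cong)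
  have sb_sym: "sb Y X = sb X Y"
    using sb X Y unfolding symmetric_bracket_def by blast
  have XY: "nabla X Y p = (1 / 2) *\<^sub>R (br X Y p + sb X Y p) + (1 / 2) *\<^sub>R T p (X p) (Y p)"
    using nabla X Y p by blast
  have "nabla Y X p = (1 / 2) *\<^sub>R (br Y X p + sb Y X p) + (1 / 2) *\<^sub>R T p (Y p) (X p)"
    using nabla X Y p by blast
  then have YX: "nabla Y X p = (1 / 2) *\<^sub>R (- br X Y p + sb X Y p) - (1 / 2) *\<^sub>R T p (X p) (Y p)"
    by (simp add: T_skew br_skew sb_sym)
  have halves: "(1 / 2) *\<^sub>R a + (1 / 2) *\<^sub>R a = a" for a :: 'b
    by (simp flip: scaleR_add_left)
  have "torsion br nabla X Y p =
      ((1 / 2) *\<^sub>R br X Y p + (1 / 2) *\<^sub>R br X Y p) - br X Y p +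
      ((1 / 2) *\<^sub>R T p (X p) (Y p) + (1 / 2) *\<^sub>R T p (X p) (Y p))"
    unfolding torsion_def XY YX by (simp add: algebra_simps del: scaleR_half_double)
  then show ?thesis
    by (simp only: halves) simp
qed

text \<open>
  Freezing the first argument of the torsion \<open>3\<close>-form at \<open>X p\<close> leaves an alternating bilinear form on
  the fibre. For the connection \<open>\<nabla>\<close> of the theorem this sign change says that every \<open>T(X, \<cdot>)\<close> is
  skew-adjoint with respect to \<open>g\<close>.
\<close>

lemma metric_torsion_swap:
  assumes A: "vector_bundle M A"
    and tors: "totally_skew_symmetric_torsion M A br g nabla"
    and X: "X \<in> sections M A" and Y: "Y \<in> sections M A" and Z: "Z \<in> sections M A"
    and p: "p \<in> points M"
  shows "g p (torsion br nabla X Y p) (Z p) = - g p (torsion br nabla X Z p) (Y p)"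
proof -
  obtain \<omega> where \<omega>: "three_form M A \<omega>"
    and tors_\<omega>: "\<forall>X\<in>sections M A. \<forall>Y\<in>sections M A. \<forall>Z\<in>sections M A. \<forall>p\<in>points M.
      g p (torsion br nabla X Y p) (Z p) = \<omega> p (X p) (Y p) (Z p)"
    using tors unfolding totally_skew_symmetric_torsion_def by (elim exE conjE)
  have g\<omega>: "g p (torsion br nabla X V p) (W p) = \<omega> p (X p) (V p) (W p)"
    if "V \<in> sections M A" "W \<in> sections M A" for V W
    using tors_\<omega> X that p by (simp only: Ball_def)
  have Xp: "X p \<in> fibre A p"
    using X p by (rule section_in_fibre)
  have bil: "bilinear_between (fibre A p) UNIV (\<lambda>b c. \<omega> p (X p) b c)"
    using \<omega> p Xp unfolding three_form_def by blast
  have alt: "\<omega> p (X p) a a = 0" if "a \<in> fibre A p" for a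
    using \<omega> p Xp that unfolding three_form_def by blast
  have "\<omega> p (X p) (Y p) (Z p) = - \<omega> p (X p) (Z p) (Y p)"
    by (rule alternating_bilinear_skew[OF bil subspace_fibre[OF A p] alt
          section_in_fibre[OF Y p] section_in_fibre[OF Z p]])
  then show ?thesis
    using X Y Z by (simp add: g\<omega>)
qed

theorem theorem5p1:
  fixes M :: "'m manifold"
    and A :: "('m, 'v::real_vector) vbundle"
    and \<rho> :: "'m \<Rightarrow> 'v \<Rightarrow> ('m \<Rightarrow> real) \<Rightarrow> real"
    and br sb nabla :: "('m \<Rightarrow> 'v) \<Rightarrow> ('m \<Rightarrow> 'v) \<Rightarrow> 'm \<Rightarrow> 'v"
    and g :: "'m \<Rightarrow> 'v \<Rightarrow> 'v \<Rightarrow> real"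
    and T :: "'m \<Rightarrow> 'v \<Rightarrow> 'v \<Rightarrow> 'v"
    and X :: "'m \<Rightarrow> 'v"
  assumes "skew_symmetric_algebroid M A \<rho> br"
    and "pseudo_riemannian_metric M A g"
    and "symmetric_bracket M A \<rho> sb"
    and "vector_valued_two_form M A T"
    and "A_connection M A \<rho> nabla"
    and "\<forall>X\<in>sections M A. \<forall>Y\<in>sections M A. \<forall>p\<in>points M.
           nabla X Y p = (1 / 2) *\<^sub>R (br X Y p + sb X Y p) + (1 / 2) *\<^sub>R T p (X p) (Y p)"
    and "totally_skew_symmetric_torsion M A br g nabla"
    and "X \<in> sections M A"
  shows "\<forall>Y\<in>sections M A. \<forall>Z\<in>sections M A. \<forall>p\<in>points M.
           covariant_derivative_metric \<rho> nabla g X Y Z p =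
             (1 / 2) * (alternating_lie_derivative_metric \<rho> br g X Y Z p +
                        symmetric_lie_derivative_metric \<rho> sb g X Y Z p)"
proof (intro ballI)
  fix Y Z p
  assume Y: "Y \<in> sections M A" and Z: "Z \<in> sections M A" and p: "p \<in> points M"
  let ?E = "fibre A p"
  have vb: "vector_bundle M A" and br: "section_bilinear M A br"
    using assms(1) unfolding skew_symmetric_algebroid_def by blast+
  have sb: "section_bilinear M A sb"
    using assms(3) unfolding symmetric_bracket_def by blast
  have E: "subspace ?E"
    using vb p by (rule subspace_fibre)
  have g: "bilinear_between ?E UNIV (g p)"
    and g_sym: "\<And>a b. a \<in> ?E \<Longrightarrow> b \<in> ?E \<Longrightarrow> g p a b = g p b a"
    using assms(2) p unfolding pseudo_riemannian_metric_def symmetric_two_tensor_def by blast+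
  have g_add: "g p (a + b) c = g p a c + g p b c"
    and g_scale: "g p (r *\<^sub>R a) c = r * g p a c"
    if "a \<in> ?E" "b \<in> ?E" "c \<in> ?E" for a b c r
    using g that unfolding bilinear_between_def by auto
  have T_in: "T p a b \<in> ?E" if "a \<in> ?E" "b \<in> ?E" for a b
    using assms(4) p that unfolding vector_valued_two_form_def bilinear_between_def by blast
  have in_E: "W p \<in> ?E" if "W \<in> sections M A" for W
    using that p by (rule section_in_fibre)

  have half_sum: "g p (nabla X V p) (W p) =
      (g p (br X V p) (W p) + g p (sb X V p) (W p)) / 2 + g p (T p (X p) (V p)) (W p) / 2"
    if V: "V \<in> sections M A" and W: "W \<in> sections M A" for V W
  proof -
    have mem: "br X V p \<in> ?E" "sb X V p \<in> ?E" "T p (X p) (V p) \<in> ?E" "W p \<in> ?E"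
      using section_bilinear_closed[OF br assms(8) V] section_bilinear_closed[OF sb assms(8) V]
        assms(8) V W in_E T_in by blast+
    have "nabla X V p = (1 / 2) *\<^sub>R (br X V p + sb X V p) + (1 / 2) *\<^sub>R T p (X p) (V p)"
      using assms(6) assms(8) V p by blast
    then show ?thesis
      using mem by (simp add: g_add g_scale subspace_add[OF E] subspace_scale[OF E])
  qed

  have swap: "g p (T p (X p) (Y p)) (Z p) = - g p (T p (X p) (Z p)) (Y p)"
    using metric_torsion_swap[OF vb assms(7,8) Y Z p]
      torsion_eq_two_form[OF assms(1,3,4,6,8) _ p] Y Z by simp
  have flip: "g p (Y p) (B X Z p) = g p (B X Z p) (Y p)" if "section_bilinear M A B" for B
    using g_sym in_E Y section_bilinear_closed[OF that assms(8) Z] by blast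
  have nabla: "section_bilinear M A nabla"
    using assms(5) unfolding A_connection_def by blast
  show "covariant_derivative_metric \<rho> nabla g X Y Z p =
      (1 / 2) * (alternating_lie_derivative_metric \<rho> br g X Y Z p +
                 symmetric_lie_derivative_metric \<rho> sb g X Y Z p)"
    unfolding covariant_derivative_metric_def alternating_lie_derivative_metric_def
      symmetric_lie_derivative_metric_def flip[OF br] flip[OF sb] flip[OF nabla]
      half_sum[OF Y Z] half_sum[OF Z Y] swap
    by (simp add: field_simps)
qed

end
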